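(* Let $\alpha>3$, $\beta>0$, $t_0>0$, and let $\Phi:\mathcal H\to\mathbb R$ be twice continuously differentiable, convex and even (i.e. $\Phi(x)=\Phi(-x)$ for all $x\in\mathcal H$). Let $x_0,\dot x_0\in\mathcal H$ and let $x:[t_0,+\infty[\to\mathcal H$ be the global classical solution of $$\ddot x(t)+\frac{\alpha}{t}\dot x(t)+\beta\nabla^2\Phi(x(t))\dot x(t)+\nabla\Phi(x(t))=0$$ with $x(t_0)=x_0$ and $\dot x(t_0)=\dot x_0$. Then $x(t)$ converges strongly, as $t\to+\infty$, to some $x^*\in\operatorname{argmin}\Phi$.
   Context: $\mathcal H$ is a real Hilbert space. A global classical solution is a twice continuously differentiable function satisfying the equation for all $t\ge t_0$. *)

theory Defs
  imports "HOL-Analysis.Analysis"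
begin

text \<open>Second-order Frechet differentiability on the whole space; continuity of the second
  derivative is with respect to the operator norm.\<close>

definition twice_continuously_differentiable ::
    "('a::real_normed_vector \<Rightarrow> 'b::real_normed_vector) \<Rightarrow> bool" where
  "twice_continuously_differentiable f \<longleftrightarrow>
    (\<exists>(D :: 'a \<Rightarrow> 'a \<Rightarrow>\<^sub>L 'b) (D2 :: 'a \<Rightarrow> 'a \<Rightarrow>\<^sub>L 'a \<Rightarrow>\<^sub>L 'b).
      (\<forall>x. (f has_derivative blinfun_apply (D x)) (at x)) \<and>
      (\<forall>x. (D has_derivative blinfun_apply (D2 x)) (at x)) \<and>
      continuous_on UNIV D2)"

text \<open>The Riesz representative of the Frechet derivative. It exists whenever \<open>\<Phi>\<close> is
  differentiable at \<open>x\<close> and the space is complete.\<close>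

definition gradient :: "('a::real_inner \<Rightarrow> real) \<Rightarrow> 'a \<Rightarrow> 'a" where
  "gradient \<Phi> x = (THE g. (\<Phi> has_derivative (\<lambda>h. inner g h)) (at x))"

definition hessian :: "('a::real_inner \<Rightarrow> real) \<Rightarrow> 'a \<Rightarrow> 'a \<Rightarrow> 'a" where
  "hessian \<Phi> x = frechet_derivative (gradient \<Phi>) (at x)"

text \<open>The trajectory is a total function of which only the values on \<open>{t0..}\<close> matter:
  derivatives are taken within \<open>{t0..}\<close>, hence are one-sided at \<open>t0\<close>. Here \<open>v\<close> and \<open>a\<close>
  are the first and second derivative of \<open>x\<close>.\<close>

definition global_classical_solution ::
    "real \<Rightarrow> real \<Rightarrow> ('a::real_inner \<Rightarrow> real) \<Rightarrow> real \<Rightarrow> 'a \<Rightarrow> 'a \<Rightarrow> (real \<Rightarrow> 'a) \<Rightarrow> bool" where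
  "global_classical_solution \<alpha> \<beta> \<Phi> t0 x0 v0 x \<longleftrightarrow>
    (\<exists>v a.
      (\<forall>t\<ge>t0. (x has_vector_derivative v t) (at t within {t0..})) \<and>
      (\<forall>t\<ge>t0. (v has_vector_derivative a t) (at t within {t0..})) \<and>
      continuous_on {t0..} a \<and>
      (\<forall>t\<ge>t0. a t + (\<alpha> / t) *\<^sub>R v t + \<beta> *\<^sub>R hessian \<Phi> (x t) (v t) + gradient \<Phi> (x t) = 0) \<and>
      x t0 = x0 \<and> v t0 = v0)"

end

theory Submission
  imports Defs
begin

text \<open>Since \<open>\<Phi>\<close> is convex and even, \<open>0\<close> is a minimizer. Put \<open>g = \<nabla>\<Phi>(x)\<close>,
  \<open>y = x' + \<beta> g\<close> and \<open>\<phi> = \<Phi>(x) - min \<Phi>\<close>; the equation becomes \<open>y' = - (\<alpha> / t) x' - g\<close>.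
  An energy \<open>E \<ge> 0\<close> of the form \<open>t (t + c) \<phi> + |\<lambda> x + t y|^2 / 2 + c' |x|^2\<close> with
  \<open>2 < \<lambda> < \<alpha> - 1\<close> eventually dissipates at rate at least
  \<open>t (\<phi> + |x'|^2 + |g|^2)\<close>, up to a constant factor. Comparison with \<open>E\<close> shows that
  \<open>t^2 (\<phi> + |y|^2 / 2)\<close> converges; its limit is \<open>0\<close>, for otherwise \<open>E\<close> would decrease
  like \<open>- ln t\<close>. Hence \<open>|x|^2\<close> converges along with \<open>E\<close>.
  For strong convergence, evenness gives
  \<open>- \<langle>g(t), x(t) + x(T)\<rangle> \<le> \<Phi>(-x(T)) - \<Phi>(x(t)) = \<Phi>(x(T)) - \<Phi>(x(t))\<close>, which bounds the growth
  of \<open>|x(t)|^2 - |x(T)|^2 - |x(t) - x(T)|^2 / 2 + t \<langle>y(t), x(t) + x(T)\<rangle> / (\<alpha> - 1)\<close> on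
  \<open>t \<le> T\<close> by the decrease of \<open>E\<close>, uniformly in \<open>T\<close>. So \<open>x\<close> is Cauchy.\<close>

section \<open>Inner-product calculus, Riesz representation and differentiability of the
  gradient\<close>

lemma has_real_derivative_inner:
  fixes f g :: "real \<Rightarrow> 'a::real_inner"
  assumes "(f has_vector_derivative f') (at t within S)"
    and "(g has_vector_derivative g') (at t within S)"
  shows "((\<lambda>t. inner (f t) (g t)) has_real_derivative
    inner (f t) g' + inner f' (g t)) (at t within S)"
  using has_derivative_inner[OF assms[unfolded has_vector_derivative_def]]
  unfolding has_field_derivative_def
  by (rule has_derivative_eq_rhs) (auto simp: algebra_simps)

lemma riesz_representation:
  fixes f :: "'a::{real_inner, complete_space} \<Rightarrow> real"
  assumes "bounded_linear f"
  shows "\<exists>w. \<forall>h. f h = inner w h"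
proof -
  \<comment> \<open>\<open>w\<close> minimizes \<open>J\<close>; minimizing sequences are Cauchy by the parallelogram law (\<open>mid\<close>).\<close>
  interpret bounded_linear f by fact
  define J where "J z = inner z z / 2 - f z" for z
  obtain K where K: "\<And>z. norm (f z) \<le> norm z * K"
    using bounded by blast
  have "J z \<ge> - (K\<^sup>2 / 2)" for z
  proof -
    have "0 \<le> (norm z - K)\<^sup>2" by simp
    moreover have "f z \<le> norm z * K" using K[of z] by simp
    ultimately show ?thesis
      by (simp add: J_def power2_diff dot_square_norm)
  qed
  then have bdd: "bdd_below (range J)" by (auto intro!: bdd_belowI)
  define m where "m = Inf (range J)"
  have m: "m \<le> J z" for z
    unfolding m_def using bdd by (auto intro: cInf_lower)
  have mid: "(norm (a - b))\<^sup>2 \<le> 4 * (J a - m) + 4 * (J b - m)" for a b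
  proof -
    have "J ((1/2) *\<^sub>R (a + b)) = J a / 2 + J b / 2 - (norm (a - b))\<^sup>2 / 8"
      unfolding J_def power2_norm_eq_inner
      by (simp add: scaleR add algebra_simps inner_commute inner_diff_left inner_diff_right inner_add_left
          inner_add_right field_simps)
    with m[of "(1/2) *\<^sub>R (a + b)"] show ?thesis by simp
  qed
  have "\<exists>z. J z < m + inverse (real (Suc n))" for n
    using cInf_lessD[of "range J" "m + inverse (real (Suc n))"] by (auto simp: m_def)
  then obtain X where X: "\<And>n. J (X n) < m + inverse (real (Suc n))" by metis
  have Jlim: "(\<lambda>n. J (X n)) \<longlonglongrightarrow> m"
  proof (rule tendsto_sandwich)
    show "\<forall>\<^sub>F n in sequentially. m \<le> J (X n)" using m by simp
    show "\<forall>\<^sub>F n in sequentially. J (X n) \<le> m + inverse (real (Suc n))"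
      using X by (simp add: less_imp_le)
    show "(\<lambda>n. m + inverse (real (Suc n))) \<longlonglongrightarrow> m"
      using tendsto_add[OF tendsto_const LIMSEQ_inverse_real_of_nat, of m] by simp
  qed simp
  have "Cauchy X"
  proof (rule metric_CauchyI)
    fix e :: real assume "e > 0"
    then have "\<forall>\<^sub>F n in sequentially. J (X n) < m + e\<^sup>2 / 8"
      by (intro order_tendstoD(2)[OF Jlim]) simp
    then obtain N where N: "\<And>n. n \<ge> N \<Longrightarrow> J (X n) < m + e\<^sup>2 / 8"
      by (auto simp: eventually_sequentially)
    have "dist (X i) (X j) < e" if "i \<ge> N" "j \<ge> N" for i j
    proof (rule power2_less_imp_less)
      show "(dist (X i) (X j))\<^sup>2 < e\<^sup>2"
        using mid[of "X i" "X j"] N[OF that(1)] N[OF that(2)] by (simp add: dist_norm)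
    qed (use \<open>e > 0\<close> in simp)
    then show "\<exists>N. \<forall>i\<ge>N. \<forall>j\<ge>N. dist (X i) (X j) < e" by blast
  qed
  then obtain w where w: "X \<longlonglongrightarrow> w"
    using Cauchy_convergent_iff convergent_def by blast
  have "(\<lambda>n. J (X n)) \<longlonglongrightarrow> J w"
    unfolding J_def by (intro tendsto_intros tendsto w) simp
  then have Jw: "J w = m" using Jlim LIMSEQ_unique by blast
  have "f h = inner w h" for h
  proof -
    define c where "c = inner w h - f h"
    define d where "d = inner h h + 1"
    \<comment> \<open>This \<open>s\<close> minimizes \<open>s * c + s^2 * d / 2\<close>, a
      quadratic with negative minimum unless \<open>c = 0\<close>. The summand 1 in \<open>d\<close>
      keeps the division legitimate for \<open>h = 0\<close>.\<close>
    define s where "s = - c / d"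
    have d: "d > 0" using inner_ge_zero[of h] unfolding d_def by linarith
    have "J (w + s *\<^sub>R h) = J w + s * c + s\<^sup>2 * inner h h / 2"
      unfolding J_def c_def
      by (simp add: scaleR add inner_commute inner_add_left inner_add_right
          field_simps power2_eq_square)
    then have "0 \<le> s * c + s\<^sup>2 * inner h h / 2"
      using m[of "w + s *\<^sub>R h"] Jw by simp
    also have "\<dots> \<le> s * c + s\<^sup>2 * d / 2"
      by (simp add: algebra_simps d_def)
    also have "\<dots> = - c\<^sup>2 / (2 * d)"
      using d unfolding s_def by (simp add: field_simps power2_eq_square)
    finally have "c\<^sup>2 \<le> 0" using d by (simp add: field_simps)
    then show ?thesis by (simp add: c_def)
  qed
  then show ?thesis by blast
qed

text \<open>Linearity comes from uniqueness of the representing vector, the norm bound from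
  evaluating \<open>f\<close> at its own representative \<open>r f\<close>. Bounded linearity of
  \<open>r\<close> is what carries differentiability of the derivative over to the gradient.\<close>

lemma bounded_linear_riesz:
  obtains r :: "('a::{real_inner, complete_space} \<Rightarrow>\<^sub>L real) \<Rightarrow> 'a"
  where "bounded_linear r" and "\<And>f h. blinfun_apply f h = inner (r f) h"
proof -
  obtain r :: "('a \<Rightarrow>\<^sub>L real) \<Rightarrow> 'a" where r: "\<And>f h. blinfun_apply f h = inner (r f) h"
    using riesz_representation[OF blinfun.bounded_linear_right] by metis
  have eqI: "a = b" if "\<And>h. inner a h = inner b h" for a b :: 'a
    using that vector_eq_rdot by blast
  have "bounded_linear r"
  proof (rule bounded_linear_intro[where K = 1])
    show "r (f + f') = r f + r f'" for f f'
      by (rule eqI) (simp add: r[symmetric] inner_add_left blinfun.add_left)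
    show "r (c *\<^sub>R f) = c *\<^sub>R r f" for c f
      by (rule eqI) (simp add: r[symmetric] blinfun.scaleR_left)
    show "norm (r f) \<le> norm f * 1" for f
    proof (cases "r f = 0")
      case False
      have "norm (r f) * norm (r f) = blinfun_apply f (r f)"
        by (simp add: r flip: dot_square_norm power2_eq_square)
      also have "\<dots> \<le> norm f * norm (r f)"
        using norm_blinfun[of f "r f"] by simp
      finally show ?thesis using False by simp
    qed simp
  qed
  with r show thesis by (rule that[rotated])
qed

lemma gradient_eqI:
  assumes "(\<Phi> has_derivative (\<lambda>h. inner g h)) (at x)"
  shows "gradient \<Phi> x = g"
  unfolding gradient_def
proof (rule the_equality)
  fix g' assume "(\<Phi> has_derivative (\<lambda>h. inner g' h)) (at x)"
  then have "inner g' h = inner g h" for h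
    using has_derivative_unique[OF assms] by metis
  then show "g' = g" using vector_eq_rdot by blast
qed fact

text \<open>The gradient is the derivative \<open>D\<close> followed by the bounded linear Riesz
  map, so it is differentiable wherever \<open>D\<close> is. Since \<open>hessian\<close> is a
  \<open>frechet_derivative\<close>, existence of some derivative already identifies it.\<close>

lemma twice_continuously_differentiable_gradient:
  fixes \<Phi> :: "'a::{real_inner, complete_space} \<Rightarrow> real"
  assumes "twice_continuously_differentiable \<Phi>"
  shows "(\<Phi> has_derivative (\<lambda>h. inner (gradient \<Phi> z) h)) (at z)"
    and "(gradient \<Phi> has_derivative hessian \<Phi> z) (at z)"
proof -
  obtain D :: "'a \<Rightarrow> 'a \<Rightarrow>\<^sub>L real" and D2 :: "'a \<Rightarrow> 'a \<Rightarrow>\<^sub>L 'a \<Rightarrow>\<^sub>L real"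
    where D: "\<And>z. (\<Phi> has_derivative blinfun_apply (D z)) (at z)"
      and D2: "\<And>z. (D has_derivative blinfun_apply (D2 z)) (at z)"
    using assms unfolding twice_continuously_differentiable_def by blast
  obtain r :: "('a \<Rightarrow>\<^sub>L real) \<Rightarrow> 'a"
    where r: "bounded_linear r" "\<And>f h. blinfun_apply f h = inner (r f) h"
    using bounded_linear_riesz by blast
  have D': "(\<Phi> has_derivative (\<lambda>h. inner (r (D z)) h)) (at z)" for z
    by (rule has_derivative_eq_rhs[OF D]) (simp add: r(2) fun_eq_iff)
  have grad: "gradient \<Phi> = (\<lambda>z. r (D z))"
    using gradient_eqI[OF D'] by blast
  show "(\<Phi> has_derivative (\<lambda>h. inner (gradient \<Phi> z) h)) (at z)"
    unfolding grad by (rule D')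
  have "(gradient \<Phi> has_derivative (\<lambda>h. r (blinfun_apply (D2 z) h))) (at z)"
    unfolding grad by (rule bounded_linear.has_derivative[OF r(1) D2])
  then show "(gradient \<Phi> has_derivative hessian \<Phi> z) (at z)"
    unfolding hessian_def using differentiableI frechet_derivative_works by blast
qed

section \<open>Convexity, evenness and limits of monotone functions\<close>

lemma convex_on_above_gradient:
  fixes \<Phi> :: "'a::real_inner \<Rightarrow> real"
  assumes "convex_on UNIV \<Phi>" and "(\<Phi> has_derivative (\<lambda>h. inner g h)) (at y)"
  shows "\<Phi> z \<ge> \<Phi> y + inner g (z - y)"
proof -
  \<comment> \<open>Restriction to the line through \<open>y\<close> and \<open>z\<close> reduces
    the claim to the tangent inequality for convex functions of one real variable.\<close>
  define f where "f s = \<Phi> (y + s *\<^sub>R (z - y))" for s :: real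
  have cf: "convex_on UNIV f"
  proof (rule convex_onI)
    fix s a b :: real assume s: "0 < s" "s < 1"
    have "y + ((1 - s) *\<^sub>R a + s *\<^sub>R b) *\<^sub>R (z - y)
        = (1 - s) *\<^sub>R (y + a *\<^sub>R (z - y)) + s *\<^sub>R (y + b *\<^sub>R (z - y))"
      by (simp add: algebra_simps)
    then show "f ((1 - s) *\<^sub>R a + s *\<^sub>R b) \<le> (1 - s) * f a + s * f b"
      unfolding f_def using s convex_onD[OF assms(1)] by simp
  qed simp
  have "(f has_derivative (\<lambda>s. inner g (s *\<^sub>R (z - y)))) (at 0)"
    unfolding f_def
    by (rule has_derivative_compose[where g = \<Phi> and f = "\<lambda>s. y + s *\<^sub>R (z - y)", THEN has_derivative_eq_rhs])
       (use assms(2) in \<open>auto intro!: derivative_eq_intros\<close>)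
  then have "(f has_real_derivative inner g (z - y)) (at 0)"
    unfolding has_field_derivative_def by (rule has_derivative_eq_rhs) (auto simp: algebra_simps)
  from convex_on_imp_above_tangent[OF cf _ _ _ this, of 1] show ?thesis
    by (simp add: f_def)
qed

text \<open>The origin is the midpoint of \<open>y\<close> and \<open>- y\<close>, where the two
  values agree.\<close>

lemma even_convex_on_min_zero:
  fixes \<Phi> :: "'a::real_vector \<Rightarrow> real"
  assumes "convex_on UNIV \<Phi>" and "\<And>y. \<Phi> (- y) = \<Phi> y"
  shows "\<Phi> 0 \<le> \<Phi> y"
  using convex_onD[OF assms(1), of "1/2" y "- y"] by (simp add: assms(2))

text \<open>The limit is the infimum over \<open>{a..}\<close>, which inherits the bound
  \<open>m\<close>.\<close>

lemma nonincreasing_bounded_below_tendsto_at_top: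
  fixes f :: "real \<Rightarrow> real"
  assumes mono: "\<And>s t. a \<le> s \<Longrightarrow> s \<le> t \<Longrightarrow> f t \<le> f s" and bound: "\<And>t. a \<le> t \<Longrightarrow> m \<le> f t"
  obtains L where "m \<le> L" and "(f \<longlongrightarrow> L) at_top"
proof
  have bdd: "bdd_below (f ` {a..})" using bound by (auto intro!: bdd_belowI)
  show "m \<le> Inf (f ` {a..})" using bound by (intro cInf_greatest) auto
  show "(f \<longlongrightarrow> Inf (f ` {a..})) at_top"
  proof (rule decreasing_tendsto)
    show "\<forall>\<^sub>F t in at_top. Inf (f ` {a..}) \<le> f t"
      using eventually_ge_at_top[of a] by eventually_elim (auto intro!: cInf_lower bdd)
    fix b assume "Inf (f ` {a..}) < b"
    then obtain s where s: "s \<ge> a" "f s < b"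
      using cInf_lessD[of "f ` {a..}" b] by auto
    show "\<forall>\<^sub>F t in at_top. f t < b"
      using eventually_ge_at_top[of s] by eventually_elim (use s mono[OF s(1)] in \<open>auto intro: le_less_trans\<close>)
  qed
qed

section \<open>The trajectory in first-order form and its energies\<close>

text \<open>The parameter \<open>\<mu>\<close> stands for \<open>(\<alpha> - 3) / 2\<close>, so that \<open>\<alpha> = 2 \<mu> + 3\<close>, and \<open>\<lambda> = \<mu> + 2\<close> is the
  midpoint of the admissible interval \<open>]2, \<alpha> - 1[\<close>.\<close>

locale damped_trajectory =
  fixes \<Phi> :: "'a::{real_inner, complete_space} \<Rightarrow> real"
    and x v g :: "real \<Rightarrow> 'a" and \<mu> \<beta> a :: real
  assumes \<mu>: "\<mu> > 0" and \<beta>: "\<beta> > 0"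
    and a: "a \<ge> \<beta> + 1" "4 * a \<ge> (2 * \<mu> + 3) * \<beta>" "\<mu> * a \<ge> 2 * \<beta> * (2 * \<mu> + 1)"
    and x_deriv: "\<And>t. t \<ge> a \<Longrightarrow> (x has_vector_derivative v t) (at t)"
    and y_deriv: "\<And>t. t \<ge> a \<Longrightarrow> ((\<lambda>t. v t + \<beta> *\<^sub>R g t) has_vector_derivative
      - ((2 * \<mu> + 3) / t) *\<^sub>R v t - g t) (at t)"
    and \<Phi>_deriv: "\<And>t. t \<ge> a \<Longrightarrow> ((\<lambda>t. \<Phi> (x t)) has_real_derivative inner (g t) (v t)) (at t)"
    and above_tangent: "\<And>t z. t \<ge> a \<Longrightarrow> \<Phi> z \<ge> \<Phi> (x t) + inner (g t) (z - x t)"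
    and \<Phi>_even: "\<And>z. \<Phi> (- z) = \<Phi> z"
    and \<Phi>_min: "\<And>z. \<Phi> 0 \<le> \<Phi> z"
begin

text \<open>Adding \<open>\<beta> *\<^sub>R g t\<close> absorbs the Hessian term, so that the
  derivative of \<open>y\<close> involves only \<open>v\<close> and \<open>g\<close>.\<close>

definition y where "y t = v t + \<beta> *\<^sub>R g t"
definition gap where "gap t = \<Phi> (x t) - \<Phi> 0"
definition D where "D t = t * (gap t + inner (v t) (v t) + inner (g t) (g t))"
text \<open>The coefficients are tuned so that two mixed terms cancel in the derivative: the weight
  of \<open>gap\<close> removes \<open>inner (g t) (v t)\<close>, and the last summand removes
  \<open>inner (x t) (v t)\<close>.\<close>

definition E where "E t = t * (t + \<beta> * (\<mu> - 1)) * gap t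
  + inner ((\<mu> + 2) *\<^sub>R x t + t *\<^sub>R y t) ((\<mu> + 2) *\<^sub>R x t + t *\<^sub>R y t) / 2
  + (\<mu> + 2) * \<mu> / 2 * inner (x t) (x t)"
text \<open>A mechanical energy with \<open>y\<close> in the place of the velocity. It is
  nonincreasing by itself, and \<open>t^2 * W t\<close> controls both \<open>gap\<close> and
  \<open>y\<close>.\<close>

definition W where "W t = gap t + inner (y t) (y t) / 2"

lemma time_pos: "t \<ge> a \<Longrightarrow> t > 0"
  using a \<beta> by linarith

lemma y_has_deriv:
  "t \<ge> a \<Longrightarrow> (y has_vector_derivative - ((2 * \<mu> + 3) / t) *\<^sub>R v t - g t) (at t)"
  using y_deriv unfolding y_def[abs_def] .

section \<open>Dissipation and boundedness of \<open>E\<close>\<close>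

lemma gap_deriv: "t \<ge> a \<Longrightarrow> (gap has_real_derivative inner (g t) (v t)) (at t)"
  unfolding gap_def[abs_def] by (rule derivative_eq_intros \<Phi>_deriv refl | simp)+

lemma gap_nonneg: "gap t \<ge> 0"
  using \<Phi>_min by (simp add: gap_def)

text \<open>This is the tangent inequality at \<open>x t\<close>, evaluated at the minimizer
  0.\<close>

lemma gap_le: "t \<ge> a \<Longrightarrow> gap t \<le> inner (x t) (g t)"
  using above_tangent[of t 0] by (simp add: gap_def inner_commute)

lemma D_nonneg: "t \<ge> a \<Longrightarrow> D t \<ge> 0"
  unfolding D_def using gap_nonneg[of t] time_pos[of t] by (intro mult_nonneg_nonneg add_nonneg_nonneg) auto

lemma E_deriv:
  assumes t: "t \<ge> a"
  obtains E' where "(E has_real_derivative E') (at t)" and "E' \<le> - (min (\<mu> / 2) \<beta> * D t)"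
proof
  define E' where "E' = (2 * t + \<beta> * (\<mu> - 1)) * gap t - (\<mu> + 2) * (t - \<beta>) * inner (x t) (g t)
    - t * \<mu> * inner (v t) (v t) - t * \<beta> * (t - \<beta>) * inner (g t) (g t)"
  define u where "u t = (\<mu> + 2) *\<^sub>R x t + t *\<^sub>R y t" for t
  \<comment> \<open>The coefficients of \<open>v t\<close> add up to (\<mu> + 2) + 1 - (2 \<mu> + 3)
    = -\<mu>; those of \<open>g t\<close> to \<beta> - t.\<close>
  define u' where "u' = - (\<mu> *\<^sub>R v t) - (t - \<beta>) *\<^sub>R g t"
  have u'_eq: "(\<mu> + 2) *\<^sub>R v t + (t *\<^sub>R (- ((2 * \<mu> + 3) / t) *\<^sub>R v t - g t) + 1 *\<^sub>R y t) = u'"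
  proof -
    have "t *\<^sub>R (- ((2 * \<mu> + 3) / t) *\<^sub>R v t - g t) = - ((2 * \<mu> + 3) *\<^sub>R v t) - t *\<^sub>R g t"
      using time_pos[OF t] by (simp add: scaleR_diff_right)
    moreover have "(\<mu> + 2) *\<^sub>R v t + (- ((2 * \<mu> + 3) *\<^sub>R v t) - t *\<^sub>R g t + 1 *\<^sub>R y t) = u'"
    proof -
      have "(2 * \<mu> + 3) *\<^sub>R v t = ((\<mu> + 2) + \<mu> + 1) *\<^sub>R v t"
        by (rule arg_cong[where f = "\<lambda>c. c *\<^sub>R v t"]) simp
      then have "(2 * \<mu> + 3) *\<^sub>R v t = (\<mu> + 2) *\<^sub>R v t + \<mu> *\<^sub>R v t + v t"
        by (simp only: scaleR_add_left scaleR_one)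
      then show ?thesis
        unfolding u'_def y_def by (simp add: scaleR_diff_left)
    qed
    ultimately show ?thesis by simp
  qed
  have u: "(u has_vector_derivative u') (at t)"
    unfolding u_def[abs_def] u'_eq[symmetric]
    by (intro has_vector_derivative_add has_vector_derivative_scaleR
        bounded_linear.has_vector_derivative[OF bounded_linear_scaleR_right]
        x_deriv y_has_deriv t DERIV_ident)
  have "((\<lambda>t. t * (t + \<beta> * (\<mu> - 1)) * gap t + inner (u t) (u t) / 2
      + (\<mu> + 2) * \<mu> / 2 * inner (x t) (x t)) has_real_derivative E') (at t)"
    by (rule derivative_eq_intros has_real_derivative_inner u x_deriv gap_deriv t refl | simp)+
      (simp add: E'_def u'_def u_def y_def inner_add_left inner_add_right inner_diff_left
        inner_diff_right inner_commute field_simps)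
  then show "(E has_real_derivative E') (at t)"
    unfolding E_def[abs_def] u_def .
  have tb: "t - \<beta> \<ge> 1" using t a by linarith
  \<comment> \<open>As \<open>t - \<beta>\<close> is at least 1, \<open>gap_le\<close> may replace
    \<open>inner (x t) (g t)\<close> by \<open>gap t\<close>, and the last term keeps a coefficient
    of order \<open>t\<close>.\<close>
  have "E' \<le> (2 * t + \<beta> * (\<mu> - 1)) * gap t - (\<mu> + 2) * (t - \<beta>) * gap t
    - t * \<mu> * inner (v t) (v t) - t * \<beta> * 1 * inner (g t) (g t)"
    unfolding E'_def using tb \<mu> \<beta>
    by (intro diff_mono mult_left_mono mult_right_mono gap_le t order_refl) auto
  also have "\<dots> = (\<beta> * (2 * \<mu> + 1) - \<mu> * t) * gap t
    - t * \<mu> * inner (v t) (v t) - t * \<beta> * inner (g t) (g t)"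
    by (simp add: algebra_simps)
  \<comment> \<open>The third threshold on \<open>a\<close> lets half of \<open>\<mu> * t\<close>
    absorb the constant \<open>\<beta> * (2 * \<mu> + 1)\<close>; the other half remains as
    dissipation.\<close>
  also have "\<dots> \<le> - (t * (\<mu> / 2)) * gap t - t * \<mu> * inner (v t) (v t) - t * \<beta> * inner (g t) (g t)"
  proof -
    have "\<mu> * a \<le> \<mu> * t" using t \<mu> by simp
    then have "\<beta> * (2 * \<mu> + 1) - \<mu> * t \<le> - (t * (\<mu> / 2))" using a(3) by (simp add: algebra_simps)
    then show ?thesis using gap_nonneg by (intro diff_mono mult_right_mono order_refl) auto
  qed
  also have "\<dots> \<le> - (t * min (\<mu> / 2) \<beta>) * gap t - t * min (\<mu> / 2) \<beta> * inner (v t) (v t)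
      - t * min (\<mu> / 2) \<beta> * inner (g t) (g t)"
    using \<mu> gap_nonneg time_pos[OF t]
    by (intro diff_mono mult_right_mono mult_left_mono le_imp_neg_le) auto
  also have "\<dots> = - (min (\<mu> / 2) \<beta> * D t)"
    by (simp add: D_def algebra_simps)
  finally show "E' \<le> - (min (\<mu> / 2) \<beta> * D t)" .
qed

text \<open>This replaces integrability of \<open>D\<close>: a function growing at most at rate \<open>C D\<close> is
  controlled by the decrease of \<open>E\<close>.\<close>

lemma growth_le_E_decrease:
  assumes st: "a \<le> s" "s \<le> t" and "C \<ge> 0"
    and deriv: "\<And>r. s \<le> r \<Longrightarrow> r \<le> t \<Longrightarrow> \<exists>f'. (f has_real_derivative f') (at r) \<and> f' \<le> C * D r"
  shows "f t - f s \<le> C / min (\<mu> / 2) \<beta> * (E s - E t)"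
proof -
  define c where "c = min (\<mu> / 2) \<beta>"
  have c: "c > 0" using \<mu> \<beta> by (simp add: c_def)
  \<comment> \<open>Growth of \<open>f\<close> at rate at most \<open>C * D\<close> is offset by
    \<open>C / c\<close> times the decrease of \<open>E\<close>, whose rate is at least
    \<open>c * D\<close>.\<close>
  have "f t + C / c * E t \<le> f s + C / c * E s"
  proof (rule DERIV_nonpos_imp_nonincreasing[OF st(2)])
    fix r assume r: "s \<le> r" "r \<le> t"
    obtain f' where f': "(f has_real_derivative f') (at r)" "f' \<le> C * D r"
      using deriv r by blast
    obtain E' where E': "(E has_real_derivative E') (at r)" "E' \<le> - (c * D r)"
      using E_deriv[OF order_trans[OF st(1) r(1)]] unfolding c_def .
    have "C / c * E' \<le> C / c * (- (c * D r))"
      using E'(2) c \<open>C \<ge> 0\<close> by (intro mult_left_mono) auto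
    then have "f' + C / c * E' \<le> 0" using f'(2) c by simp
    moreover have "((\<lambda>t. f t + C / c * E t) has_real_derivative f' + C / c * E') (at r)"
      by (intro DERIV_add DERIV_cmult f' E')
    ultimately show "\<exists>z. ((\<lambda>t. f t + C / c * E t) has_real_derivative z) (at r) \<and> z \<le> 0"
      by blast
  qed
  then show ?thesis by (simp add: algebra_simps c_def)
qed

lemma E_mono:
  assumes "a \<le> s" "s \<le> t"
  shows "E t \<le> E s"
proof (rule DERIV_nonpos_imp_nonincreasing[OF assms(2)])
  fix r assume "s \<le> r"
  then have r: "r \<ge> a" using assms by simp
  obtain E' where "(E has_real_derivative E') (at r)" "E' \<le> - (min (\<mu> / 2) \<beta> * D r)"
    using E_deriv[OF r] .
  moreover have "min (\<mu> / 2) \<beta> * D r \<ge> 0"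
    using D_nonneg[OF r] \<mu> \<beta> by simp
  ultimately show "\<exists>E'. (E has_real_derivative E') (at r) \<and> E' \<le> 0"
    by (intro exI[of _ E']) simp
qed

lemma E_ge:
  assumes t: "t \<ge> a"
  shows "(\<mu> + 2) * \<mu> / 2 * inner (x t) (x t) \<le> E t"
proof -
  \<comment> \<open>Since \<mu> may be below 1, the weight of \<open>gap\<close> is written as (t -
    \<beta>) + \<beta> \<mu> to see its sign.\<close>
  have "\<beta> * \<mu> > 0" using \<beta> \<mu> by simp
  then have "t + \<beta> * (\<mu> - 1) \<ge> 0" using a t by (simp add: algebra_simps)
  then show ?thesis
    unfolding E_def using gap_nonneg[of t] time_pos[OF t] by simp
qed

lemma E_nonneg: "t \<ge> a \<Longrightarrow> E t \<ge> 0"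
  by (rule order_trans[OF _ E_ge]) (use \<mu> in auto)

lemma E_tendsto: obtains L where "(E \<longlongrightarrow> L) at_top"
  using nonincreasing_bounded_below_tendsto_at_top[of a E 0] E_mono E_nonneg by blast

lemma x_bounded: obtains M where "M \<ge> 0" and "\<And>t. t \<ge> a \<Longrightarrow> norm (x t) \<le> M"
proof
  show "sqrt (2 * E a / ((\<mu> + 2) * \<mu>)) \<ge> 0"
    using E_nonneg[of a] \<mu> by simp
  fix t assume t: "t \<ge> a"
  have "(\<mu> + 2) * \<mu> / 2 * (norm (x t))\<^sup>2 \<le> E a"
    using E_ge[OF t] E_mono[of a t] t by (simp add: power2_norm_eq_inner)
  then show "norm (x t) \<le> sqrt (2 * E a / ((\<mu> + 2) * \<mu>))"
    using \<mu> by (intro real_le_rsqrt) (simp add: pos_le_divide_eq mult.commute)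
qed

section \<open>Monotonicity and decay of \<open>W\<close>\<close>

lemma W_deriv:
  assumes t: "t \<ge> a"
  obtains W' where "(W has_real_derivative W') (at t)" and "W' \<le> 0"
proof
  define W' where "W' = - ((2 * \<mu> + 3) / t) * (inner (v t) (v t) + \<beta> * inner (g t) (v t))
    - \<beta> * inner (g t) (g t)"
  show "(W has_real_derivative W') (at t)"
    unfolding W_def[abs_def]
    by (rule derivative_eq_intros has_real_derivative_inner y_has_deriv gap_deriv t refl | simp)+
      (simp add: W'_def y_def inner_add_left inner_add_right inner_diff_left
        inner_diff_right inner_commute algebra_simps add_divide_distrib diff_divide_distrib)
  define k where "k = (2 * \<mu> + 3) / t"
  have k: "k \<ge> 0" using time_pos[OF t] \<mu> by (simp add: k_def)
  \<comment> \<open>Completing the square in \<open>v t\<close> leaves k \<beta>^2 / 4 times |g|^2,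
    which the term -\<beta> |g|^2 dominates by the second threshold on \<open>a\<close>.\<close>
  have "k * \<beta> / 4 \<le> 1" using a(2) t time_pos[OF t] by (simp add: k_def field_simps)
  then have "k * \<beta> / 4 * \<beta> * inner (g t) (g t) \<le> 1 * \<beta> * inner (g t) (g t)"
    using \<beta> by (intro mult_right_mono) auto
  moreover have "0 \<le> k * inner (v t + (\<beta> / 2) *\<^sub>R g t) (v t + (\<beta> / 2) *\<^sub>R g t)"
    using k by simp
  ultimately show "W' \<le> 0"
    unfolding W'_def k_def[symmetric]
    by (simp add: inner_add_left inner_add_right inner_commute algebra_simps)
qed

lemma W_mono: "a \<le> s \<Longrightarrow> s \<le> t \<Longrightarrow> W t \<le> W s"
  by (rule DERIV_nonpos_imp_nonincreasing) (meson W_deriv order_trans)+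

text \<open>By the parallelogram law for \<open>v t\<close> and
  \<open>\<beta> *\<^sub>R g t\<close>.\<close>

lemma inner_y_le: "inner (y t) (y t) / 2 \<le> inner (v t) (v t) + \<beta>\<^sup>2 * inner (g t) (g t)"
  using inner_ge_zero[of "v t - \<beta> *\<^sub>R g t"]
  by (simp add: y_def inner_add_left inner_add_right inner_diff_left inner_diff_right
      inner_commute algebra_simps power2_eq_square)

lemma W_nonneg: "W t \<ge> 0"
  by (simp add: W_def gap_nonneg)

lemma W_le_D: assumes t: "t \<ge> a" shows "t * W t \<le> (1 + \<beta>\<^sup>2) * D t"
proof -
  have "W t \<le> gap t + inner (v t) (v t) + \<beta>\<^sup>2 * inner (g t) (g t)"
    using inner_y_le[of t] by (simp add: W_def)
  also have "\<dots> \<le> (1 + \<beta>\<^sup>2) * (gap t + inner (v t) (v t) + inner (g t) (g t))"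
    using gap_nonneg[of t] by (simp add: algebra_simps)
  finally show ?thesis using time_pos[OF t] by (simp add: D_def mult.left_commute)
qed

lemma W_tendsto: "((\<lambda>t. t\<^sup>2 * W t) \<longlongrightarrow> 0) at_top"
proof -
  \<comment> \<open>\<open>W\<close> is nonincreasing, so \<open>t^2 * W t\<close> grows at rate at
    most \<open>2 * t * W t\<close>. The factor 2 comes from this, the other factor from
    \<open>W_le_D\<close>.\<close>
  define C where "C = 2 * (1 + \<beta>\<^sup>2)"
  define c where "c = min (\<mu> / 2) \<beta>"
  have c: "c > 0" using \<mu> \<beta> by (simp add: c_def)
  have C: "C > 0" by (simp add: C_def add_pos_nonneg)
  have "t\<^sup>2 * W t + C / c * E t \<le> s\<^sup>2 * W s + C / c * E s" if st: "a \<le> s" "s \<le> t" for s t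
  proof -
    have "\<exists>f'. ((\<lambda>t. t\<^sup>2 * W t) has_real_derivative f') (at r) \<and> f' \<le> C * D r"
      if "s \<le> r" "r \<le> t" for r
    proof -
      have r: "r \<ge> a" using st that by simp
      obtain W' where W': "(W has_real_derivative W') (at r)" "W' \<le> 0"
        using W_deriv[OF r] .
      have "((\<lambda>t. t\<^sup>2 * W t) has_real_derivative 2 * (r * W r) + r\<^sup>2 * W') (at r)"
        by (rule derivative_eq_intros W' refl | simp)+
      moreover have "2 * (r * W r) + r\<^sup>2 * W' \<le> C * D r"
        using W_le_D[OF r] mult_nonneg_nonpos[OF zero_le_power2 W'(2), of r]
        unfolding C_def by linarith
      ultimately show ?thesis by blast
    qed
    from growth_le_E_decrease[OF st _ this] show ?thesis
      using C by (simp add: algebra_simps c_def)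
  qed
  moreover have "0 \<le> t\<^sup>2 * W t + C / c * E t" if "t \<ge> a" for t
    using W_nonneg E_nonneg[OF that] C c by simp
  ultimately obtain L1 where L1: "((\<lambda>t. t\<^sup>2 * W t + C / c * E t) \<longlongrightarrow> L1) at_top"
    using nonincreasing_bounded_below_tendsto_at_top[of a "\<lambda>t. t\<^sup>2 * W t + C / c * E t" 0] by blast
  obtain L2 where "(E \<longlongrightarrow> L2) at_top" using E_tendsto .
  then have "((\<lambda>t. t\<^sup>2 * W t + C / c * E t - C / c * E t) \<longlongrightarrow> L1 - C / c * L2) at_top"
    by (intro tendsto_intros L1)
  then obtain l where l: "((\<lambda>t. t\<^sup>2 * W t) \<longlongrightarrow> l) at_top" by auto
  have "l \<ge> 0"
    by (rule tendsto_lowerbound[OF l]) (simp_all add: W_nonneg)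
  moreover have False if "l > 0"
  proof -
    have "\<forall>\<^sub>F t in at_top. t\<^sup>2 * W t > l / 2"
      using l that by (intro order_tendstoD(1)) auto
    then obtain s0 where s0: "\<And>t. t \<ge> s0 \<Longrightarrow> t\<^sup>2 * W t > l / 2"
      by (auto simp: eventually_at_top_linorder)
    define s where "s = max s0 a"
    have s: "s \<ge> a" by (simp add: s_def)
    \<comment> \<open>From l / 2 < r^2 W(r) and r W(r) \<le> (C / 2) D(r) follows 1 / r \<le> (C /
      l) D(r). Hence the decrease of \<open>E\<close> would bound the growth of \<open>ln\<close>,
      which is impossible as \<open>E\<close> is nonnegative.\<close>
    define K where "K = C / l"
    have K: "K > 0" using C that by (simp add: K_def)
    have "ln t \<le> ln s + K / c * E s" if t: "t \<ge> s" for t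
    proof -
      have "\<exists>f'. (ln has_real_derivative f') (at r) \<and> f' \<le> K * D r" if "s \<le> r" "r \<le> t" for r
      proof -
        have r: "r \<ge> a" and rp: "r > 0" using s that time_pos by force+
        have "l / 2 < r * (r * W r)" using s0[of r] that by (simp add: s_def power2_eq_square mult.assoc)
        also have "\<dots> \<le> r * (C / 2 * D r)"
        proof (rule mult_left_mono)
          have "C / 2 = 1 + \<beta>\<^sup>2" by (simp add: C_def)
          then show "r * W r \<le> C / 2 * D r" using W_le_D[OF r] by (simp only:)
        qed (use rp in simp)
        finally have "1 / r \<le> K * D r"
          using rp \<open>l > 0\<close> by (simp add: K_def field_simps)
        moreover have "(ln has_real_derivative 1 / r) (at r)"
          using rp DERIV_ln_divide by blast
        ultimately show ?thesis by blast
      qed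
      from growth_le_E_decrease[OF s t _ this]
      have "ln t - ln s \<le> K / c * (E s - E t)" using K by (simp add: c_def)
      also have "\<dots> \<le> K / c * E s"
        using E_nonneg[of t] K c s t by (intro mult_left_mono) auto
      finally show ?thesis by simp
    qed
    moreover have "\<forall>\<^sub>F t in at_top. ln t > ln s + K / c * E s"
      using ln_at_top by (simp add: filterlim_at_top_dense)
    then obtain s1 where "\<And>t. t \<ge> s1 \<Longrightarrow> ln t > ln s + K / c * E s"
      by (auto simp: eventually_at_top_linorder)
    ultimately show False
      by (metis max.cobounded1 max.cobounded2 not_less)
  qed
  ultimately show ?thesis using l by (cases "l = 0") auto
qed

section \<open>Rates for \<open>y\<close> and \<open>gap\<close>, and convergence of the
  norm\<close>

lemma y_tendsto: "((\<lambda>t. t * norm (y t)) \<longlongrightarrow> 0) at_top"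
proof -
  have "((\<lambda>t. (t * norm (y t))\<^sup>2) \<longlongrightarrow> 0) at_top"
  proof (rule tendsto_sandwich[OF _ _ tendsto_const])
    show "\<forall>\<^sub>F t in at_top. (t * norm (y t))\<^sup>2 \<le> 2 * (t\<^sup>2 * W t)"
      by (simp add: W_def power_mult_distrib power2_norm_eq_inner algebra_simps gap_nonneg)
    show "((\<lambda>t. 2 * (t\<^sup>2 * W t)) \<longlongrightarrow> 0) at_top"
      using tendsto_mult_right_zero[OF W_tendsto] by simp
  qed simp
  from tendsto_real_sqrt[OF this] have "((\<lambda>t. \<bar>t * norm (y t)\<bar>) \<longlongrightarrow> 0) at_top" by simp
  then show ?thesis by (rule tendsto_rabs_zero_cancel)
qed

lemma gap_tendsto: "((\<lambda>t. t\<^sup>2 * gap t) \<longlongrightarrow> 0) at_top"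
proof (rule tendsto_sandwich[OF _ _ tendsto_const W_tendsto])
  show "\<forall>\<^sub>F t in at_top. t\<^sup>2 * gap t \<le> t\<^sup>2 * W t"
    by (simp add: W_def mult_left_mono)
qed (simp add: gap_nonneg)

lemma norm_x_tendsto: obtains L where "((\<lambda>t. (norm (x t))\<^sup>2) \<longlongrightarrow> L) at_top"
proof -
  obtain M where M: "M \<ge> 0" "\<And>t. t \<ge> a \<Longrightarrow> norm (x t) \<le> M" using x_bounded by blast
  have inv: "((\<lambda>t::real. 1 / t) \<longlongrightarrow> 0) at_top"
    using tendsto_inverse_0_at_top[OF filterlim_ident] by (simp add: inverse_eq_divide)
  have xy: "((\<lambda>t. t * inner (x t) (y t)) \<longlongrightarrow> 0) at_top"
  proof (rule Lim_null_comparison)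
    show "\<forall>\<^sub>F t in at_top. norm (t * inner (x t) (y t)) \<le> M * (t * norm (y t))"
      using eventually_ge_at_top[of a]
    proof eventually_elim
      case (elim t)
      have "\<bar>inner (x t) (y t)\<bar> \<le> M * norm (y t)"
        using Cauchy_Schwarz_ineq2[of "x t" "y t"] mult_right_mono[OF M(2)[OF elim], of "norm (y t)"]
        by simp
      then have "t * \<bar>inner (x t) (y t)\<bar> \<le> t * (M * norm (y t))"
        using time_pos[OF elim] by simp
      then show ?case using time_pos[OF elim] by (simp add: abs_mult algebra_simps)
    qed
    show "((\<lambda>t. M * (t * norm (y t))) \<longlongrightarrow> 0) at_top"
      by (rule tendsto_mult_right_zero[OF y_tendsto])
  qed
  have yy: "((\<lambda>t. (t * norm (y t))\<^sup>2) \<longlongrightarrow> 0) at_top"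
    using tendsto_power[OF y_tendsto, of 2] by simp
  obtain L where L: "(E \<longlongrightarrow> L) at_top" using E_tendsto .
  \<comment> \<open>Expanding the square in \<open>E\<close> isolates |x|^2 with coefficient (\<mu>
    + 2)^2 / 2 + (\<mu> + 2) \<mu> / 2 = (\<mu> + 2) (\<mu> + 1); every other summand tends to
    0.\<close>
  have "((\<lambda>t. (E t - (t\<^sup>2 * gap t) * (1 + \<beta> * (\<mu> - 1) * (1 / t)) - (\<mu> + 2) * (t * inner (x t) (y t))
      - (t * norm (y t))\<^sup>2 / 2) / ((\<mu> + 2) * (\<mu> + 1)))
      \<longlongrightarrow> (L - 0 * (1 + \<beta> * (\<mu> - 1) * 0) - (\<mu> + 2) * 0 - 0 / 2) / ((\<mu> + 2) * (\<mu> + 1))) at_top"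
    using \<mu> by (intro tendsto_intros L gap_tendsto inv xy yy) auto
  moreover have "\<forall>\<^sub>F t in at_top. (E t - (t\<^sup>2 * gap t) * (1 + \<beta> * (\<mu> - 1) * (1 / t))
      - (\<mu> + 2) * (t * inner (x t) (y t)) - (t * norm (y t))\<^sup>2 / 2) / ((\<mu> + 2) * (\<mu> + 1))
      = (norm (x t))\<^sup>2"
    using eventually_ge_at_top[of a]
  proof eventually_elim
    case (elim t)
    have "E t - (t\<^sup>2 * gap t) * (1 + \<beta> * (\<mu> - 1) * (1 / t))
      - (\<mu> + 2) * (t * inner (x t) (y t)) - (t * norm (y t))\<^sup>2 / 2
      = (\<mu> + 2) * (\<mu> + 1) * (norm (x t))\<^sup>2"
      using time_pos[OF elim]
      unfolding E_def power_mult_distrib power2_norm_eq_inner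
      by (simp add: inner_add_left inner_add_right inner_commute power2_eq_square field_simps)
    then show ?case using \<mu> by simp
  qed
  ultimately show thesis by (rule that[OF Lim_transform_eventually])
qed

section \<open>The Cauchy property and strong convergence\<close>

lemma distance_estimate:
  assumes st: "a \<le> s" "s \<le> T"
  shows "(norm (x s - x T))\<^sup>2 / 2 \<le> (norm (x s))\<^sup>2 - (norm (x T))\<^sup>2
    + (5 / 2 + 3 / 2 * \<beta>\<^sup>2) / (2 * (\<mu> + 1)) / min (\<mu> / 2) \<beta> * (E s - E T)
    + s / (2 * (\<mu> + 1)) * inner (y s) (x s + x T) - T / (\<mu> + 1) * inner (y T) (x T)"
proof -
  \<comment> \<open>The first three terms have derivative \<open>inner (v t) (x t + x T)\<close>.
    The last one cancels it, because \<open>t\<close> times the derivative of \<open>y\<close>, plus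
    \<open>y\<close>, contains \<open>v\<close> with coefficient -2 (\<mu> + 1).\<close>
  define R where "R t = inner (x t) (x t) - inner (x T) (x T) - inner (x t - x T) (x t - x T) / 2
    + t * inner (y t) (x t + x T) / (2 * (\<mu> + 1))" for t
  define C where "C = (5 / 2 + 3 / 2 * \<beta>\<^sup>2) / (2 * (\<mu> + 1))"
  have C: "C \<ge> 0" using \<mu> by (simp add: C_def)
  have "\<exists>f'. (R has_real_derivative f') (at r) \<and> f' \<le> C * D r" if "s \<le> r" "r \<le> T" for r
  proof -
    have r: "r \<ge> a" and rp: "r > 0" and rb: "r - \<beta> \<ge> 0"
      using st that time_pos a \<beta> by force+
    define R' where "R' = (- (r - \<beta>) * inner (g r) (x r + x T) + r * inner (v r) (v r)
      + r * \<beta> * inner (g r) (v r)) / (2 * (\<mu> + 1))"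
    have xr: "((\<lambda>t. x t + x T) has_vector_derivative v r) (at r)"
        "((\<lambda>t. x t - x T) has_vector_derivative v r) (at r)"
      using x_deriv[OF r] by (auto intro!: derivative_eq_intros)
    have "(R has_real_derivative
        inner (x r) (v r) + inner (v r) (x r) - (inner (x r - x T) (v r) + inner (v r) (x r - x T)) / 2
        + (r * (inner (y r) (v r) + inner (- ((2 * \<mu> + 3) / r) *\<^sub>R v r - g r) (x r + x T))
           + inner (y r) (x r + x T)) / (2 * (\<mu> + 1))) (at r)"
      unfolding R_def[abs_def] using \<mu>
      by (auto intro!: derivative_eq_intros has_real_derivative_inner y_has_deriv x_deriv xr r)
        (simp add: add_divide_distrib mult.commute)
    also have "r * (inner (y r) (v r) + inner (- ((2 * \<mu> + 3) / r) *\<^sub>R v r - g r) (x r + x T))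
        = r * inner (y r) (v r) - (2 * \<mu> + 3) * inner (v r) (x r + x T) - r * inner (g r) (x r + x T)"
      using rp by (simp add: inner_diff_left right_diff_distrib distrib_left)
    also have "inner (x r) (v r) + inner (v r) (x r) - (inner (x r - x T) (v r) + inner (v r) (x r - x T)) / 2
        = inner (v r) (x r + x T)"
      by (simp add: inner_add_right inner_diff_left inner_diff_right inner_commute diff_divide_distrib)
    also have "inner (v r) (x r + x T)
        + (r * inner (y r) (v r) - (2 * \<mu> + 3) * inner (v r) (x r + x T) - r * inner (g r) (x r + x T)
           + inner (y r) (x r + x T)) / (2 * (\<mu> + 1)) = R'"
      using \<mu> unfolding R'_def y_def by (simp add: inner_add_left field_simps)
    finally have "(R has_real_derivative R') (at r)" .
    moreover have "R' \<le> C * D r"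
    proof -
      \<comment> \<open>The tangent at \<open>x r\<close> is evaluated at the reflected endpoint
        \<open>- x T\<close>. Then \<open>gap T \<le> W T \<le> W r\<close> removes the endpoint, so
        the resulting bound does not depend on \<open>T\<close>.\<close>
      have "- inner (g r) (x r + x T) \<le> \<Phi> (x T) - \<Phi> (x r)"
        using above_tangent[OF r, of "- x T"]
        by (simp add: \<Phi>_even inner_diff_right inner_add_right)
      also have "\<dots> \<le> inner (y r) (y r) / 2"
        using W_mono[of r T] r that inner_ge_zero[of "y T"]
        unfolding W_def gap_def by linarith
      finally have *: "- inner (g r) (x r + x T) \<le> inner (y r) (y r) / 2" .
      have "- (r - \<beta>) * inner (g r) (x r + x T) \<le> (r - \<beta>) * (inner (y r) (y r) / 2)"
        using mult_left_mono[OF * rb] by (simp only: mult_minus_left mult_minus_right)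
      also have "\<dots> \<le> r * (inner (y r) (y r) / 2)"
        using \<beta> by (intro mult_right_mono) auto
      finally have "- (r - \<beta>) * inner (g r) (x r + x T) + r * inner (v r) (v r)
        + r * \<beta> * inner (g r) (v r)
        \<le> r * (inner (y r) (y r) / 2 + inner (v r) (v r) + \<beta> * inner (g r) (v r))"
        by (simp add: algebra_simps)
      \<comment> \<open>The left side is 3/2 |v|^2 + 2 \<beta> <g, v> + \<beta>^2 / 2 |g|^2, and 2
        \<beta> <g, v> is at most |v|^2 + \<beta>^2 |g|^2.\<close>
      also have "inner (y r) (y r) / 2 + inner (v r) (v r) + \<beta> * inner (g r) (v r)
        \<le> 5 / 2 * inner (v r) (v r) + 3 / 2 * \<beta>\<^sup>2 * inner (g r) (g r)"
        using inner_ge_zero[of "v r - \<beta> *\<^sub>R g r"]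
        by (simp add: y_def inner_add_left inner_add_right inner_diff_left inner_diff_right
          inner_commute field_simps power2_eq_square)
      also have "\<dots> \<le> (5 / 2 + 3 / 2 * \<beta>\<^sup>2) * (gap r + inner (v r) (v r) + inner (g r) (g r))"
      proof -
        define K where "K = 5 / 2 + 3 / 2 * \<beta>\<^sup>2"
        have K: "5 / 2 \<le> K" "3 / 2 * \<beta>\<^sup>2 \<le> K" "0 \<le> K" by (simp_all add: K_def)
        have "5 / 2 * inner (v r) (v r) \<le> K * inner (v r) (v r)"
          "3 / 2 * \<beta>\<^sup>2 * inner (g r) (g r) \<le> K * inner (g r) (g r)"
          by (intro mult_right_mono K inner_ge_zero)+
        moreover have "0 \<le> K * gap r" using K(3) gap_nonneg by simp
        ultimately show ?thesis unfolding K_def[symmetric] distrib_left by linarith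
      qed
      finally have "R' \<le> r * ((5 / 2 + 3 / 2 * \<beta>\<^sup>2) * (gap r + inner (v r) (v r) + inner (g r) (g r)))
          / (2 * (\<mu> + 1))"
        unfolding R'_def using rp \<mu> by (simp add: divide_right_mono)
      then show ?thesis by (simp add: C_def D_def mult_ac)
    qed
    ultimately show ?thesis by blast
  qed
  from growth_le_E_decrease[OF st C this]
  have "R T - R s \<le> C / min (\<mu> / 2) \<beta> * (E s - E T)" .
  moreover have "R T = T / (\<mu> + 1) * inner (y T) (x T)"
    using \<mu> by (simp add: R_def inner_add_right field_simps)
  ultimately show ?thesis
    by (simp add: R_def C_def power2_norm_eq_inner)
qed

lemma trajectory_converges: obtains z where "(x \<longlongrightarrow> z) at_top"
proof -
  define C where "C = (5 / 2 + 3 / 2 * \<beta>\<^sup>2) / (2 * (\<mu> + 1)) / min (\<mu> / 2) \<beta>"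
  obtain M where M: "M \<ge> 0" "\<And>t. t \<ge> a \<Longrightarrow> norm (x t) \<le> M" using x_bounded by blast
  \<comment> \<open>Both boundary terms of \<open>distance_estimate\<close> are bounded by
    \<open>e\<close>, since each sum of two positions has norm at most \<open>2 * M\<close>.\<close>
  define e where "e t = M / (\<mu> + 1) * (t * norm (y t))" for t
  have est: "\<bar>t / (2 * (\<mu> + 1)) * inner (y t) (x t + x s)\<bar> \<le> e t" if "t \<ge> a" "s \<ge> a" for s t
  proof -
    have "\<bar>inner (y t) (x t + x s)\<bar> \<le> norm (y t) * norm (x t + x s)"
      by (rule Cauchy_Schwarz_ineq2)
    also have "\<dots> \<le> norm (y t) * (2 * M)"
      using norm_triangle_le[of "x t" "x s" "2 * M"] M(2)[OF that(1)] M(2)[OF that(2)]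
      by (intro mult_left_mono) auto
    finally have "t / (2 * (\<mu> + 1)) * \<bar>inner (y t) (x t + x s)\<bar>
        \<le> t / (2 * (\<mu> + 1)) * (norm (y t) * (2 * M))"
      using time_pos[OF that(1)] \<mu> by (intro mult_left_mono) auto
    also have "\<dots> = e t" using \<mu> by (simp add: e_def field_simps)
    finally show ?thesis using time_pos[OF that(1)] \<mu> by (simp add: abs_mult)
  qed
  have e: "(e \<longlongrightarrow> 0) at_top"
    unfolding e_def[abs_def] by (rule tendsto_mult_right_zero[OF y_tendsto])
  obtain L1 L2 where "((\<lambda>t. (norm (x t))\<^sup>2) \<longlongrightarrow> L1) at_top" "(E \<longlongrightarrow> L2) at_top"
    using norm_x_tendsto E_tendsto by metis
  \<comment> \<open>\<open>h\<close> gathers the terms of the estimate that enter as differences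
    between the two times; it converges because |x|^2 and \<open>E\<close> do.\<close>
  define h where "h t = (norm (x t))\<^sup>2 + C * E t" for t
  define L where "L = L1 + C * L2"
  have h: "(h \<longlongrightarrow> L) at_top"
    unfolding h_def[abs_def] L_def by (intro tendsto_intros) fact+
  have dist: "(norm (x s - x t))\<^sup>2 / 2 \<le> h s - h t + e s + e t" if "a \<le> s" "s \<le> t" for s t
  proof -
    have "- (t / (\<mu> + 1) * inner (y t) (x t)) \<le> e t"
    proof -
      have "inner (y t) (x t + x t) = 2 * inner (y t) (x t)" by (simp add: inner_add_right)
      then have "t / (2 * (\<mu> + 1)) * inner (y t) (x t + x t) = t / (\<mu> + 1) * inner (y t) (x t)"
        using \<mu> by (simp add: divide_simps)
      then show ?thesis using est[of t t] that by linarith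
    qed
    moreover have "s / (2 * (\<mu> + 1)) * inner (y s) (x s + x t) \<le> e s"
      using est[of s t] that by linarith
    moreover have "h s - h t = (norm (x s))\<^sup>2 - (norm (x t))\<^sup>2 + C * (E s - E t)"
      by (simp add: h_def right_diff_distrib)
    ultimately show ?thesis
      using distance_estimate[OF that] unfolding C_def[symmetric] by linarith
  qed
  have "cauchy_filter (filtermap x at_top)"
    unfolding cauchy_filter_metric_filtermap
  proof (intro allI impI)
    fix \<epsilon> :: real assume "\<epsilon> > 0"
    \<comment> \<open>Four errors below \<open>d\<close> bound half the squared distance: two from
      \<open>h\<close> around its limit and two from \<open>e\<close>. Hence 8 d =
      \<epsilon>^2.\<close>
    define d where "d = \<epsilon>\<^sup>2 / 8"
    have d: "d > 0" using \<open>\<epsilon> > 0\<close> by (simp add: d_def)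
    define P where "P t \<longleftrightarrow> t \<ge> a \<and> \<bar>h t - L\<bar> < d \<and> e t < d" for t
    have "\<forall>\<^sub>F t in at_top. \<bar>h t - L\<bar> < d"
      using tendstoD[OF h d] by (simp add: dist_real_def)
    moreover have "\<forall>\<^sub>F t in at_top. e t < d"
      using order_tendstoD(2)[OF e d] .
    ultimately have "eventually P at_top"
      unfolding P_def using eventually_ge_at_top[of a] by eventually_elim auto
    moreover have less: "dist (x s) (x t) < \<epsilon>" if "P s" "P t" "s \<le> t" for s t
    proof (rule power2_less_imp_less)
      have "(norm (x s - x t))\<^sup>2 / 2 < 4 * d"
        using dist[of s t] that unfolding P_def by linarith
      then show "(dist (x s) (x t))\<^sup>2 < \<epsilon>\<^sup>2" by (simp add: d_def dist_norm)
    qed (use \<open>\<epsilon> > 0\<close> in simp)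
    then have "dist (x s) (x t) < \<epsilon>" if "P s" "P t" for s t
      using less[of s t] less[of t s] that by (cases "s \<le> t") (auto simp: dist_commute)
    ultimately show "\<exists>P. eventually P at_top \<and> (\<forall>s t. P s \<and> P t \<longrightarrow> dist (x s) (x t) < \<epsilon>)"
      by blast
  qed
  then have "\<exists>z. filtermap x at_top \<le> nhds z"
    by (rule cauchy_filter_complete_converges[OF _ complete_UNIV])
       (auto simp: filtermap_bot_iff)
  then show thesis using that by (auto simp: filterlim_def)
qed

end

section \<open>Reduction of the differential equation to the first-order setting, and identification
  of the limit\<close>

theorem theorem2p1:
  fixes \<Phi> :: "'a::{real_inner, complete_space} \<Rightarrow> real"
    and x :: "real \<Rightarrow> 'a" and x0 v0 :: 'a and \<alpha> \<beta> t0 :: real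
  assumes "\<alpha> > 3" and "\<beta> > 0" and "t0 > 0"
    and "twice_continuously_differentiable \<Phi>"
    and "convex_on UNIV \<Phi>"
    and "\<forall>y. \<Phi> y = \<Phi> (- y)"
    and "global_classical_solution \<alpha> \<beta> \<Phi> t0 x0 v0 x"
  shows "\<exists>xstar. is_arg_min \<Phi> (\<lambda>_. True) xstar \<and> (x \<longlongrightarrow> xstar) at_top"
proof -
  note \<Phi>_grad = twice_continuously_differentiable_gradient(1)[OF assms(4)]
  note grad_hess = twice_continuously_differentiable_gradient(2)[OF assms(4)]
  obtain v acc where
    x': "\<And>t. t \<ge> t0 \<Longrightarrow> (x has_vector_derivative v t) (at t within {t0..})" and
    v': "\<And>t. t \<ge> t0 \<Longrightarrow> (v has_vector_derivative acc t) (at t within {t0..})" and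
    ode: "\<And>t. t \<ge> t0 \<Longrightarrow>
      acc t + (\<alpha> / t) *\<^sub>R v t + \<beta> *\<^sub>R hessian \<Phi> (x t) (v t) + gradient \<Phi> (x t) = 0"
    using assms(7) unfolding global_classical_solution_def by blast
  have at: "at t within {t0..} = at t" if "t > t0" for t
    using that by (intro at_within_interior) simp
  define \<mu> where "\<mu> = (\<alpha> - 3) / 2"
  have \<mu>: "\<mu> > 0" using assms(1) by (simp add: \<mu>_def)
  have \<alpha>: "\<alpha> = 2 * \<mu> + 3" by (simp add: \<mu>_def field_simps)
  define g where "g t = gradient \<Phi> (x t)" for t
  \<comment> \<open>\<open>t0 + 1\<close> makes every \<open>t \<ge> a\<close> interior, so
    one-sided derivatives become two-sided; the other entries are the three thresholds of the
    locale.\<close>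
  define a where "a = max (max (t0 + 1) (\<beta> + 1))
    (max ((2 * \<mu> + 3) * \<beta> / 4) (2 * \<beta> * (2 * \<mu> + 1) / \<mu>))"
  have a: "a \<ge> t0 + 1" "a \<ge> \<beta> + 1" "a \<ge> (2 * \<mu> + 3) * \<beta> / 4" "a \<ge> 2 * \<beta> * (2 * \<mu> + 1) / \<mu>"
    unfolding a_def by (simp_all only: le_max_iff_disj order_refl simp_thms)
  have a': "(2 * \<mu> + 3) * \<beta> \<le> 4 * a" "2 * \<beta> * (2 * \<mu> + 1) \<le> \<mu> * a"
    using a(3,4) \<mu> by (simp_all add: pos_divide_le_eq mult.commute)
  have even: "\<Phi> (- z) = \<Phi> z" for z using assms(6) by metis
  have min: "\<Phi> 0 \<le> \<Phi> z" for z by (rule even_convex_on_min_zero[OF assms(5) even])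
  interpret damped_trajectory \<Phi> x v g \<mu> \<beta> a
  proof
    fix t assume "t \<ge> a"
    then have t: "t > t0" using a(1) by linarith
    show xt: "(x has_vector_derivative v t) (at t)"
      using x'[of t] t by (simp add: at)
    have "(v has_vector_derivative acc t) (at t)"
      using v'[of t] t by (simp add: at)
    \<comment> \<open>By the chain rule, differentiating \<open>g\<close> along the trajectory
      yields exactly the Hessian term of the equation.\<close>
    moreover have "(g has_vector_derivative hessian \<Phi> (x t) (v t)) (at t)"
      unfolding g_def[abs_def]
      using vector_derivative_diff_chain_within[of x "v t" t UNIV "gradient \<Phi>"] xt grad_hess
      by (simp add: o_def has_derivative_at_withinI)
    ultimately have "((\<lambda>t. v t + \<beta> *\<^sub>R g t) has_vector_derivative
        acc t + \<beta> *\<^sub>R hessian \<Phi> (x t) (v t)) (at t)"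
      by (auto intro!: derivative_eq_intros)
    moreover have "acc t + \<beta> *\<^sub>R hessian \<Phi> (x t) (v t) = - ((2 * \<mu> + 3) / t) *\<^sub>R v t - g t"
    proof -
      have "acc t + \<beta> *\<^sub>R hessian \<Phi> (x t) (v t) - (- ((2 * \<mu> + 3) / t) *\<^sub>R v t - g t)
          = acc t + (\<alpha> / t) *\<^sub>R v t + \<beta> *\<^sub>R hessian \<Phi> (x t) (v t) + gradient \<Phi> (x t)"
        unfolding g_def \<alpha> by simp
      also have "\<dots> = 0" using ode t by simp
      finally show ?thesis by simp
    qed
    ultimately show "((\<lambda>t. v t + \<beta> *\<^sub>R g t) has_vector_derivative
        - ((2 * \<mu> + 3) / t) *\<^sub>R v t - g t) (at t)" by simp
    show "((\<lambda>t. \<Phi> (x t)) has_real_derivative inner (g t) (v t)) (at t)"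
      unfolding has_field_derivative_def
      by (rule has_derivative_eq_rhs[OF has_derivative_compose[OF
              xt[unfolded has_vector_derivative_def] \<Phi>_grad]])
        (simp add: g_def fun_eq_iff mult.commute)
    show "\<Phi> z \<ge> \<Phi> (x t) + inner (g t) (z - x t)" for z
      unfolding g_def by (rule convex_on_above_gradient[OF assms(5) \<Phi>_grad])
  qed (use \<mu> assms(2) a(2) a' even min in simp_all)
  obtain z where z: "(x \<longlongrightarrow> z) at_top" using trajectory_converges .
  have "isCont \<Phi> z" by (rule has_derivative_continuous[OF \<Phi>_grad])
  then have "((\<lambda>t. \<Phi> (x t)) \<longlongrightarrow> \<Phi> z) at_top"
    by (rule isCont_tendsto_compose[OF _ z])
  then have gap1: "(gap \<longlongrightarrow> \<Phi> z - \<Phi> 0) at_top"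
    unfolding gap_def[abs_def] by (rule tendsto_diff[OF _ tendsto_const])
  \<comment> \<open>For \<open>t \<ge> 1\<close> the decay of \<open>t^2 * gap t\<close> passes to
    \<open>gap t\<close>. Comparison with the limit given by continuity of \<Phi> shows that
    \<open>z\<close> attains the minimum.\<close>
  have gap2: "(gap \<longlongrightarrow> 0) at_top"
  proof (rule tendsto_sandwich[OF _ _ tendsto_const gap_tendsto])
    show "\<forall>\<^sub>F t in at_top. gap t \<le> t\<^sup>2 * gap t"
      using eventually_ge_at_top[of 1]
    proof eventually_elim
      case (elim t)
      have "1 * gap t \<le> t\<^sup>2 * gap t"
        using elim gap_nonneg by (intro mult_right_mono) auto
      then show ?case by simp
    qed
  qed (simp add: gap_nonneg)
  have "\<Phi> z = \<Phi> 0"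
    using tendsto_unique[OF _ gap1 gap2] by simp
  then have "is_arg_min \<Phi> (\<lambda>_. True) z"
    unfolding is_arg_min_def using \<Phi>_min by (simp add: not_less)
  with z show ?thesis by blast
qed

end
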